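(* Consider the two-player zero-sum sequential game described in the context. Suppose that there exists $m\in\mathbb{N}$ such that $$\rho:=\sup_{\pi_R\in\overline\Pi_R,\ \pi_P\in\overline\Pi_P,\ s\in\mathcal S}\mathbb{P}^{\pi_R,\pi_P}[S_m\neq\Delta\mid S_0=s]<1 .$$ Fix $u_0\in\mathbb{R}^{|\mathcal S|}$ with $u_0(\Delta)=0$. Then: (a) $\lim_{k\to\infty}u_k(s)=V^*(s)$ for all $s\in\mathcal S$, where $u_k:=Tu_{k-1}$ for all $k\in\mathbb{N}$. (b) For any $\pi_R\in\Pi_R$ and $\pi_P\in\Pi_P$, we have $\lim_{k\to\infty}\tilde u_k(s)=V^{\pi_R,\pi_P}(s)$ for all $s\in\mathcal S$, where $\tilde u_0:=u_0$ and $\tilde u_k:=T_{\pi_R,\pi_P}\tilde u_{k-1}$ for all $k\in\mathbb{N}$.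
   Context: **States.** $\mathcal X$ is the set of $s=(b,c,d,o)$ with $b\in\{0,1\}^3$, $c\in\{0,1,2,3\}\times\{0,1,2\}$, $d\in\{0,1,2\}$, $o\in\{0,1,2\}$. $\widetilde{\mathcal X}=\{0,1,2,3\}$ is a set of four "penultimate" states (disjoint from $\mathcal X$), and $\Delta$ is a terminal state. The state space is the finite set $\mathcal S=\mathcal X\cup\widetilde{\mathcal X}\cup\{\Delta\}$. **Actions.** There are a runner (maximizer) and a pitcher (minimizer); $\delta$ is a dummy action. The runner's action set is $A_R(s)=[0,20]$ if $s=(b,c,d,o)\in\mathcal X$ with $b=(1,0,0)$, and $A_R(s)=\{\delta\}$ for all other $s\in\mathcal S$. For $a_R\in A_R(s)$, the pitcher's action set is $A_P(s,a_R)=\{0,1\}$ if $s=(b,c,d,o)\in\mathcal X$ with $b=(1,0,0)$, and $A_P(s,a_R)=\{\delta\}$ for all other $s\in\mathcal S$. **Transitions.** For all $s\in\mathcal S$, $a_R\in A_R(s)$, $a_P\in A_P(s,a_R)$, $p(\cdot\mid s,a_R,a_P)$ is a probability distribution on $\mathcal S$. Every state of $\widetilde{\mathcal X}$ moves to $\Delta$ with probability 1, and $\Delta$ is absorbing. At each stage the runner chooses $a_R\in A_R(s)$ after observing $s$; the pitcher chooses $a_P\in A_P(s,a_R)$ after observing $(s,a_R)$; the next state is drawn from $p(\cdot\mid s,a_R,a_P)$. **Rewards.** With $g:\{0,1\}^3\to\{0,1,2,3\}$ the number of ones in $b$, the reward for a transition from $s$ to $s'$ is $r(s'|s)=(g(b)+o)-(g(b')+o')+\mathbb{I}\{c'=(0,0),\,d'=0\}$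 if $s=(b,c,d,o),\,s'=(b',c',d',o')\in\mathcal X$; $r(s'|s)=s'$ if $s\in\mathcal X$, $s'\in\widetilde{\mathcal X}$; $r(s'|s)=0$ if $s'=\Delta$. The remaining pairs have transition probability zero; their reward is irrelevant and may be set to $0$. **Policies.** $\mathbb{F}_R$ is the set of functions $f$ on $\mathcal S$ with $f(s)\in A_R(s)$ for all $s$. $\mathbb{K}_P=\{(s,a_R): s\in\mathcal S,\ a_R\in A_R(s)\}$, and $\mathbb{F}_P$ is the set of functions $f$ on $\mathbb{K}_P$ with $f(s,a_R)\in A_P(s,a_R)$ for all $(s,a_R)\in\mathbb K_P$. A deterministic Markovian policy for the runner (resp. pitcher) is a sequence $(\pi_0,\pi_1,\ldots)$ in $\mathbb{F}_R$ (resp. $\mathbb{F}_P$); the set of these is $\overline\Pi_R$ (resp. $\overline\Pi_P$). It is stationary if all $\pi_t$ equal one decision rule; $\Pi_R\subseteq\overline\Pi_R$ and $\Pi_P\subseteq\overline\Pi_P$ denote the sets of stationary policies, and a stationary policy is identified with its decision rule. **Values.** $S_t$ is the state at stage $t$; $\mathbb{P}^{\pi_R,\pi_P}$ and $\mathbb{E}^{\pi_R,\pi_P}$ are the probability and expectation induced by the policies. Define $$V^{\pi_R,\pi_P}(s)=\mathbb{E}^{\pi_R,\pi_P}\Big[\sum_{t=0}^\infty r(S_{t+1}|S_t)\,\Big|\,S_0=s\Big],\qquad V^*(s)=\max_{\pi_R\in\overline\Pi_R}\min_{\pi_P\in\overline\Pi_P}V^{\pi_R,\pi_P}(s),\quad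 s\in\mathcal S.$$ **Operators.** For $u\in\mathbb{R}^{|\mathcal S|}$ with $u(\Delta)=0$, $\pi_R\in\Pi_R$, $\pi_P\in\Pi_P$, and $s\in\mathcal S$, $$(T_{\pi_R,\pi_P}u)(s)=\sum_{s'\in\mathcal S}[r(s'|s)+u(s')]\,p(s'|s,\pi_R(s),\pi_P(s,\pi_R(s))),$$ $$(Tu)(s)=\max_{a_R\in A_R(s)}\ \min_{a_P\in A_P(s,a_R)}\ \sum_{s'\in\mathcal S}[r(s'|s)+u(s')]\,p(s'|s,a_R,a_P).$$ In the definitions of $V^*$ and $T$, max and min are read as supremum and infimum wherever attainment is not guaranteed. *)

theory Defs
  imports "HOL-Probability.Probability"
begin

text \<open>
  A state (b, c, d, o) of \<open>\<X>\<close> is \<open>Play b c d outs\<close>; the penultimate states are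
  \<open>Penult i\<close> with \<open>i \<in> {0,1,2,3}\<close>; \<open>Terminal\<close> is \<open>\<Delta>\<close>.  The datatype is larger than the state
  space, which is the finite set \<open>state_space\<close>.
\<close>

datatype state =
    Play "nat \<times> nat \<times> nat" "nat \<times> nat" nat nat
  | Penult nat
  | Terminal

instance state :: countable
  by countable_datatype

definition play_states :: "state set" where
  "play_states = {Play b c d outs | b c d outs.
     b \<in> {0, 1} \<times> {0, 1} \<times> {0, 1} \<and> c \<in> {0, 1, 2, 3} \<times> {0, 1, 2} \<and>
     d \<in> {0, 1, 2} \<and> outs \<in> {0, 1, 2}}"

definition penult_states :: "state set" where
  "penult_states = Penult ` {0, 1, 2, 3}"

definition state_space :: "state set" where
  "state_space = play_states \<union> penult_states \<union> {Terminal}"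

lemma finite_state_space: "finite state_space"
proof -
  define A :: "((nat \<times> nat \<times> nat) \<times> (nat \<times> nat) \<times> nat \<times> nat) set" where
    "A = ({0, 1} \<times> {0, 1} \<times> {0, 1}) \<times> ({0, 1, 2, 3} \<times> {0, 1, 2}) \<times> {0, 1, 2} \<times> {0, 1, 2}"
  have "x \<in> (\<lambda>(b, c, d, outs). Play b c d outs) ` A" if "x \<in> play_states" for x
  proof -
    from that obtain b c d outs where x: "x = Play b c d outs" and "(b, c, d, outs) \<in> A"
      unfolding play_states_def A_def mem_Collect_eq mem_Sigma_iff by blast
    then show ?thesis
      by (intro image_eqI[of _ _ "(b, c, d, outs)"]) (simp_all only: prod.case)
  qed
  then have "play_states \<subseteq> (\<lambda>(b, c, d, outs). Play b c d outs) ` A"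
    by (rule subsetI)
  moreover have "finite A"
    unfolding A_def by (intro finite_cartesian_product finite.intros)
  ultimately have "finite play_states"
    by (meson finite_imageI finite_subset)
  then show ?thesis
    by (simp add: state_space_def penult_states_def)
qed

text \<open>\<open>Dummy\<close> is the dummy action \<open>\<delta>\<close>.\<close>

datatype 'a action = Act 'a | Dummy

definition active_states :: "state set" where
  "active_states = {Play (1, 0, 0) c d outs | c d outs. Play (1, 0, 0) c d outs \<in> play_states}"

definition runner_actions :: "state \<Rightarrow> real action set" where
  "runner_actions s = (if s \<in> active_states then Act ` {0..20} else {Dummy})"

definition pitcher_actions :: "state \<Rightarrow> real action \<Rightarrow> nat action set" where
  "pitcher_actions s a = (if s \<in> active_states then Act ` {0, 1} else {Dummy})"

type_synonym transition = "state \<Rightarrow> real action \<Rightarrow> nat action \<Rightarrow> state pmf"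

definition transition_law :: "transition \<Rightarrow> bool" where
  "transition_law p \<longleftrightarrow>
     (\<forall>s\<in>state_space. \<forall>a\<in>runner_actions s. \<forall>a'\<in>pitcher_actions s a.
        set_pmf (p s a a') \<subseteq> state_space) \<and>
     (\<forall>s\<in>penult_states. pmf (p s Dummy Dummy) Terminal = 1) \<and>
     pmf (p Terminal Dummy Dummy) Terminal = 1"

fun num_ones :: "nat \<times> nat \<times> nat \<Rightarrow> nat" where
  "num_ones (b1, b2, b3) = of_bool (b1 = 1) + of_bool (b2 = 1) + of_bool (b3 = 1)"

text \<open>\<open>reward s s'\<close> is \<open>r(s'|s)\<close>.\<close>

fun reward :: "state \<Rightarrow> state \<Rightarrow> real" where
  "reward (Play b c d outs) (Play b' c' d' outs') =
     (real (num_ones b) + real outs) - (real (num_ones b') + real outs')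
       + of_bool (c' = (0, 0) \<and> d' = 0)"
| "reward (Play b c d outs) (Penult i) = real i"
| "reward _ _ = 0"

type_synonym runner_rule = "state \<Rightarrow> real action"
type_synonym pitcher_rule = "state \<times> real action \<Rightarrow> nat action"

definition runner_rules :: "runner_rule set" where
  "runner_rules = (\<Pi>\<^sub>E s\<in>state_space. runner_actions s)"

definition pitcher_rules :: "pitcher_rule set" where
  "pitcher_rules =
     (\<Pi>\<^sub>E (s, a) \<in> (SIGMA s:state_space. runner_actions s). pitcher_actions s a)"

definition runner_policies :: "(nat \<Rightarrow> runner_rule) set" where
  "runner_policies = {\<pi>. \<forall>t. \<pi> t \<in> runner_rules}"

definition pitcher_policies :: "(nat \<Rightarrow> pitcher_rule) set" where
  "pitcher_policies = {\<pi>. \<forall>t. \<pi> t \<in> pitcher_rules}"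

definition stationary :: "'f \<Rightarrow> nat \<Rightarrow> 'f" where
  "stationary f = (\<lambda>t. f)"

text \<open>
  The law of the state process \<open>(S\<^sub>t)\<close> given \<open>S\<^sub>0 = s\<close>: \<open>step_kernel p \<pi>R \<pi>P s t \<omega>\<close> is the
  conditional law of \<open>S\<^sub>t\<close> given the history \<open>\<omega>\<close> up to stage \<open>t - 1\<close>, and \<open>path_measure\<close> is the
  measure on trajectories \<open>nat \<Rightarrow> state\<close> obtained from these kernels by the theorem of
  Ionescu-Tulcea.  The coordinate map \<open>\<lambda>\<omega>. \<omega> t\<close> is \<open>S\<^sub>t\<close>.
\<close>

fun step_kernel ::
  "transition \<Rightarrow> (nat \<Rightarrow> runner_rule) \<Rightarrow> (nat \<Rightarrow> pitcher_rule) \<Rightarrow> state \<Rightarrow>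
   nat \<Rightarrow> (nat \<Rightarrow> state) \<Rightarrow> state measure" where
  "step_kernel p \<pi>R \<pi>P s 0 \<omega> = measure_pmf (return_pmf s)"
| "step_kernel p \<pi>R \<pi>P s (Suc t) \<omega> =
     measure_pmf (p (\<omega> t) (\<pi>R t (\<omega> t)) (\<pi>P t (\<omega> t, \<pi>R t (\<omega> t))))"

lemma Ionescu_Tulcea_step_kernel:
  "Ionescu_Tulcea (step_kernel p \<pi>R \<pi>P s) (\<lambda>_. count_space UNIV)"
proof (rule Ionescu_Tulcea.intro)
  fix i
  show "step_kernel p \<pi>R \<pi>P s i \<in>
      PiM {0..<i} (\<lambda>_. count_space UNIV) \<rightarrow>\<^sub>M subprob_algebra (count_space UNIV)"
  proof (cases i)
    case 0
    have "step_kernel p \<pi>R \<pi>P s 0 = (\<lambda>_. measure_pmf (return_pmf s))"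
      by (rule ext) simp
    with 0 show ?thesis
      by (simp add: measure_pmf_in_subprob_algebra del: step_kernel.simps)
  next
    case (Suc t)
    have "(\<lambda>\<omega>. \<omega> t) \<in> PiM {0..<Suc t} (\<lambda>_. count_space UNIV :: state measure) \<rightarrow>\<^sub>M count_space UNIV"
      by (rule measurable_component_singleton) simp
    moreover have "(\<lambda>x. measure_pmf (p x (\<pi>R t x) (\<pi>P t (x, \<pi>R t x)))) \<in>
        count_space UNIV \<rightarrow>\<^sub>M subprob_algebra (count_space UNIV)"
      by (simp add: measure_pmf_in_subprob_algebra)
    ultimately have "(\<lambda>\<omega>. measure_pmf (p (\<omega> t) (\<pi>R t (\<omega> t)) (\<pi>P t (\<omega> t, \<pi>R t (\<omega> t))))) \<in>
        PiM {0..<Suc t} (\<lambda>_. count_space UNIV) \<rightarrow>\<^sub>M subprob_algebra (count_space UNIV)"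
      by (rule measurable_compose)
    moreover have "step_kernel p \<pi>R \<pi>P s (Suc t) =
        (\<lambda>\<omega>. measure_pmf (p (\<omega> t) (\<pi>R t (\<omega> t)) (\<pi>P t (\<omega> t, \<pi>R t (\<omega> t)))))"
      by (rule ext) simp
    ultimately show ?thesis
      using Suc by simp
  qed
next
  fix i and x :: "nat \<Rightarrow> state"
  show "prob_space (step_kernel p \<pi>R \<pi>P s i x)"
    by (cases i) (simp_all add: measure_pmf.prob_space_axioms)
qed

definition path_measure ::
  "transition \<Rightarrow> (nat \<Rightarrow> runner_rule) \<Rightarrow> (nat \<Rightarrow> pitcher_rule) \<Rightarrow> state \<Rightarrow> (nat \<Rightarrow> state) measure" where
  "path_measure p \<pi>R \<pi>P s =
     projective_family.lim UNIV
       (Ionescu_Tulcea.CI (step_kernel p \<pi>R \<pi>P s) (\<lambda>_. count_space UNIV)) (\<lambda>_. count_space UNIV)"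

text \<open>The number \<open>\<rho>\<close> for a given \<open>m\<close>.\<close>

definition max_survival_prob :: "transition \<Rightarrow> nat \<Rightarrow> real" where
  "max_survival_prob p m =
     (SUP (\<pi>R, \<pi>P, s) \<in> runner_policies \<times> pitcher_policies \<times> state_space.
        \<P>(\<omega> in path_measure p \<pi>R \<pi>P s. \<omega> m \<noteq> Terminal))"

text \<open>
  The expectation, the series and the real-valued suprema and infima below are meaningful when
  \<open>max_survival_prob p m < 1\<close> for some \<open>m\<close>: the terminal state is then reached almost surely, in a
  time whose expectation is bounded uniformly in the policies, and no further reward is earned.
\<close>

definition policy_value ::
  "transition \<Rightarrow> (nat \<Rightarrow> runner_rule) \<Rightarrow> (nat \<Rightarrow> pitcher_rule) \<Rightarrow> state \<Rightarrow> real" where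
  "policy_value p \<pi>R \<pi>P s = (\<integral>\<omega>. (\<Sum>t. reward (\<omega> t) (\<omega> (Suc t))) \<partial>path_measure p \<pi>R \<pi>P s)"

definition game_value :: "transition \<Rightarrow> state \<Rightarrow> real" where
  "game_value p s = (SUP \<pi>R\<in>runner_policies. INF \<pi>P\<in>pitcher_policies. policy_value p \<pi>R \<pi>P s)"

definition backup :: "transition \<Rightarrow> (state \<Rightarrow> real) \<Rightarrow> state \<Rightarrow> real action \<Rightarrow> nat action \<Rightarrow> real" where
  "backup p u s a a' = (\<Sum>s'\<in>state_space. (reward s s' + u s') * pmf (p s a a') s')"

definition policy_operator ::
  "transition \<Rightarrow> runner_rule \<Rightarrow> pitcher_rule \<Rightarrow> (state \<Rightarrow> real) \<Rightarrow> state \<Rightarrow> real" where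
  "policy_operator p f h u s = backup p u s (f s) (h (s, f s))"

definition bellman_operator :: "transition \<Rightarrow> (state \<Rightarrow> real) \<Rightarrow> state \<Rightarrow> real" where
  "bellman_operator p u s =
     (SUP a\<in>runner_actions s. INF a'\<in>pitcher_actions s a. backup p u s a a')"

end

theory Submission
  imports Defs
begin

text \<open>
  The survival probability decays geometrically, uniformly in the policies: by the Markov property
  each block of \<open>m\<close> stages costs a factor \<open>\<rho>\<close>, since the time-shifted policies are again
  admissible.  Hence the value of any pair of Markov policies differs from its \<open>n\<close>-stage value with
  final payoff \<open>u\<^sub>0\<close> by at most \<open>\<tau> n\<close>, where \<open>\<tau>\<close> tends to 0 and does not depend on the policies or
  the initial state.  Now \<open>(T ^^ n) u\<^sub>0\<close> is the value of the \<open>n\<close>-stage game, up to \<open>\<epsilon>\<close>: the runner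
  guarantees it by nearly maximizing the successive backups, and the pitcher holds the runner to it
  by minimizing them.  The pitcher's response depends on the observed action only, not on the
  runner's policy.  So \<open>(T ^^ n) u\<^sub>0\<close> is within \<open>\<tau> n\<close> of \<open>V\<^sup>*\<close>, with no contraction or fixed point
  argument.
\<close>

section \<open>The law of the state process\<close>

definition next_law :: "transition \<Rightarrow> runner_rule \<Rightarrow> pitcher_rule \<Rightarrow> state \<Rightarrow> state pmf" where
  "next_law p f h x = p x (f x) (h (x, f x))"

text \<open>The marginal law of \<open>S_t\<close> as an iterated bind. Once
  \<open>distr_path_pair\<close> has linked it to the path measure, all estimates concern discrete
  laws supported, for admissible policies, in the finite state space.\<close>

primrec state_law ::
  "transition \<Rightarrow> (nat \<Rightarrow> runner_rule) \<Rightarrow> (nat \<Rightarrow> pitcher_rule) \<Rightarrow> state \<Rightarrow> nat \<Rightarrow> state pmf" where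
  "state_law p \<pi> \<sigma> s 0 = return_pmf s"
| "state_law p \<pi> \<sigma> s (Suc t) = state_law p \<pi> \<sigma> s t \<bind> next_law p (\<pi> t) (\<sigma> t)"

text \<open>The joint law of \<open>S_t\<close> and \<open>S_{t+1}\<close>. A stage reward depends
  on this pair alone, so no larger marginal of the path measure is required.\<close>

definition pair_law ::
  "transition \<Rightarrow> (nat \<Rightarrow> runner_rule) \<Rightarrow> (nat \<Rightarrow> pitcher_rule) \<Rightarrow> state \<Rightarrow> nat \<Rightarrow> (state \<times> state) pmf" where
  "pair_law p \<pi> \<sigma> s t =
     state_law p \<pi> \<sigma> s t \<bind> (\<lambda>x. map_pmf (Pair x) (next_law p (\<pi> t) (\<sigma> t) x))"

text \<open>The Markov property in Chapman-Kolmogorov form: from stage \<open>t\<close> on, the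
  process is a fresh one under the time-shifted policies. It is associativity of bind.\<close>

lemma state_law_add:
  "state_law p \<pi> \<sigma> s (t + m) =
     state_law p \<pi> \<sigma> s t \<bind> (\<lambda>x. state_law p (\<lambda>i. \<pi> (t + i)) (\<lambda>i. \<sigma> (t + i)) x m)"
  by (induction m) (simp_all add: bind_return_pmf' bind_assoc_pmf)

text \<open>As \<open>state\<close> is countable, the product of two discrete sigma-algebras is
  discrete; any function of two coordinates is therefore measurable.\<close>

lemma measurable_coordinate_pair:
  assumes "i \<in> J" "j \<in> J"
  shows "(\<lambda>\<omega>. (\<omega> i, \<omega> j)) \<in> PiM J (\<lambda>_. count_space UNIV :: state measure) \<rightarrow>\<^sub>M count_space UNIV"
proof -
  have "(\<lambda>\<omega>. (\<omega> i, \<omega> j)) \<in> PiM J (\<lambda>_. count_space UNIV :: state measure) \<rightarrow>\<^sub>M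
      (count_space UNIV \<Otimes>\<^sub>M count_space UNIV)"
    using assms by (intro measurable_Pair measurable_component_singleton)
  then show ?thesis
    by (simp add: pair_measure_countable)
qed

lemma borel_measurable_coordinate_pair:
  fixes F :: "state \<times> state \<Rightarrow> ennreal"
  assumes "i \<in> J" "j \<in> J"
  shows "(\<lambda>\<omega>. F (\<omega> i, \<omega> j)) \<in> borel_measurable (PiM J (\<lambda>_. count_space UNIV))"
  by (rule measurable_compose[OF measurable_coordinate_pair[OF assms]]) simp

context
  fixes p :: transition and \<pi> :: "nat \<Rightarrow> runner_rule" and \<sigma> :: "nat \<Rightarrow> pitcher_rule" and s :: state
begin

interpretation IT: Ionescu_Tulcea "step_kernel p \<pi> \<sigma> s" "\<lambda>_. count_space UNIV"
  by (rule Ionescu_Tulcea_step_kernel)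

lemma path_measure_eq: "path_measure p \<pi> \<sigma> s = IT.PF.lim"
  by (simp add: path_measure_def)

lemma sets_path_measure [measurable_cong]:
  "sets (path_measure p \<pi> \<sigma> s) = sets (PiM UNIV (\<lambda>_. count_space UNIV))"
  unfolding path_measure_eq by (rule IT.PF.sets_lim)

text \<open>\<open>IT.C 0 n\<close> is the law of the first \<open>n\<close> coordinates, grown from
  the empty history \<open>\<lambda>_. undefined\<close>. It is extended by one kernel at a time, so
  the newest coordinate can be integrated out first.\<close>

lemma nn_integral_C_Suc:
  assumes "F \<in> borel_measurable (PiM {0..<Suc n} (\<lambda>_. count_space UNIV))"
  shows "(\<integral>\<^sup>+\<omega>. F \<omega> \<partial>IT.C 0 (Suc n) (\<lambda>_. undefined)) =
    (\<integral>\<^sup>+\<omega>. (\<integral>\<^sup>+x. F (fun_upd \<omega> n x) \<partial>step_kernel p \<pi> \<sigma> s n \<omega>) \<partial>IT.C 0 n (\<lambda>_. undefined))"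
proof -
  have "(\<integral>\<^sup>+\<omega>. F \<omega> \<partial>IT.C 0 (Suc n) (\<lambda>_. undefined)) =
    (\<integral>\<^sup>+\<omega>. (\<integral>\<^sup>+\<omega>'. F \<omega>' \<partial>IT.eP n \<omega>) \<partial>IT.C 0 n (\<lambda>_. undefined))"
    using assms IT.measurable_eP[of n] IT.sets_C[of "\<lambda>_. undefined" 0 n]
    by (simp add: nn_integral_bind[where B = "PiM {0..<Suc n} (\<lambda>_. count_space UNIV)"]
        space_PiM cong: measurable_cong_sets)
  also have "\<dots> = (\<integral>\<^sup>+\<omega>. (\<integral>\<^sup>+x. F (fun_upd \<omega> n x) \<partial>step_kernel p \<pi> \<sigma> s n \<omega>) \<partial>IT.C 0 n (\<lambda>_. undefined))"
    using assms by (intro nn_integral_cong IT.nn_integral_eP) (simp_all add: IT.space_C space_PiM)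
  finally show ?thesis .
qed

text \<open>Integrating out \<open>S_{t+1}\<close> leaves a function of \<open>S_t\<close>, to which
  the hypothesis applies. The marginal at \<open>t\<close> is a hypothesis because the induction
  that proves it uses this lemma in its successor step.\<close>

lemma nn_integral_C_pair:
  assumes "\<And>F :: state \<Rightarrow> ennreal. (\<integral>\<^sup>+\<omega>. F (\<omega> t) \<partial>IT.C 0 (Suc t) (\<lambda>_. undefined)) =
    (\<integral>\<^sup>+x. F x \<partial>state_law p \<pi> \<sigma> s t)"
  shows "(\<integral>\<^sup>+\<omega>. F (\<omega> t, \<omega> (Suc t)) \<partial>IT.C 0 (Suc (Suc t)) (\<lambda>_. undefined)) =
    (\<integral>\<^sup>+z. F z \<partial>pair_law p \<pi> \<sigma> s t)"
  using assms[of "\<lambda>x. \<integral>\<^sup>+y. F (x, y) \<partial>next_law p (\<pi> t) (\<sigma> t) x"]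
  by (subst nn_integral_C_Suc)
     (simp_all add: borel_measurable_coordinate_pair next_law_def pair_law_def del: IT.C.simps)

lemma nn_integral_C_single:
  fixes F :: "state \<Rightarrow> ennreal"
  shows "(\<integral>\<^sup>+\<omega>. F (\<omega> t) \<partial>IT.C 0 (Suc t) (\<lambda>_. undefined)) = (\<integral>\<^sup>+x. F x \<partial>state_law p \<pi> \<sigma> s t)"
proof (induction t arbitrary: F)
  case 0
  have "prob_space (IT.C 0 0 (\<lambda>_. undefined))"
    by (rule IT.prob_space_C) (simp add: space_PiM)
  then have "emeasure (IT.C 0 0 (\<lambda>_. undefined)) (space (IT.C 0 0 (\<lambda>_. undefined))) = 1"
    by (rule prob_space.emeasure_space_1)
  then show ?case
    using borel_measurable_coordinate_pair[of 0 "{0..<Suc 0}" 0 "\<lambda>z. F (fst z)"]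
    by (subst nn_integral_C_Suc) (simp_all del: IT.C.simps)
next
  case (Suc t)
  show ?case
    using nn_integral_C_pair[OF Suc.IH, of "\<lambda>z. F (snd z)"]
    by (simp add: pair_law_def del: IT.C.simps)
qed

lemma distr_path_pair:
  "distr (path_measure p \<pi> \<sigma> s) (count_space UNIV) (\<lambda>\<omega>. (\<omega> t, \<omega> (Suc t))) =
     measure_pmf (pair_law p \<pi> \<sigma> s t)"
proof (rule measure_eqI)
  let ?M = "\<lambda>_. count_space UNIV :: state measure"
  define n where "n = Suc (Suc t)"
  have less: "t \<in> {0..<n}" "Suc t \<in> {0..<n}"
    by (simp_all add: n_def)
  \<comment> \<open>\<open>IT.CI J\<close> is built from the prefix law of length
    \<open>up_to J\<close>, the least length covering \<open>J\<close>; for an initial segment this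
    is its own length.\<close>
  have up: "IT.up_to {0..<n} = n"
    using IT.up_to_less[where J = "{0..<n}" and i = "Suc t"] IT.up_to_iff[where J = "{0..<n}" and n = n] by (simp add: n_def)
  fix A :: "(state \<times> state) set"
  let ?F = "\<lambda>\<omega>. indicator A (\<omega> t, \<omega> (Suc t)) :: ennreal"
  have meas_F: "?F \<in> borel_measurable (PiM J ?M)" if "t \<in> J" "Suc t \<in> J" for J
    using that by (rule borel_measurable_coordinate_pair)
  have [measurable]: "(\<lambda>\<omega>. restrict \<omega> {0..<n}) \<in> PiM UNIV ?M \<rightarrow>\<^sub>M PiM {0..<n} ?M"
    by (rule measurable_restrict_subset) simp
  have pair: "(\<lambda>\<omega>. (\<omega> t, \<omega> (Suc t))) \<in> PiM UNIV ?M \<rightarrow>\<^sub>M count_space UNIV"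
    by (rule measurable_coordinate_pair) simp_all
  have "emeasure (distr IT.PF.lim (count_space UNIV) (\<lambda>\<omega>. (\<omega> t, \<omega> (Suc t)))) A =
      (\<integral>\<^sup>+z. indicator A z \<partial>distr IT.PF.lim (count_space UNIV) (\<lambda>\<omega>. (\<omega> t, \<omega> (Suc t))))"
    by simp
  also have "\<dots> = (\<integral>\<^sup>+\<omega>. ?F \<omega> \<partial>IT.PF.lim)"
    using pair by (subst nn_integral_distr) (simp_all add: measurable_cong_sets[OF IT.PF.sets_lim refl])
  also have "\<dots> = (\<integral>\<^sup>+\<omega>. ?F \<omega> \<partial>distr IT.PF.lim (PiM {0..<n} ?M) (\<lambda>\<omega>. restrict \<omega> {0..<n}))"
    using less by (subst nn_integral_distr) (simp_all add: meas_F measurable_cong_sets[OF IT.PF.sets_lim refl])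
  also have "\<dots> = (\<integral>\<^sup>+\<omega>. ?F \<omega> \<partial>distr (IT.C 0 n (\<lambda>_. undefined)) (PiM {0..<n} ?M) (\<lambda>\<omega>. restrict \<omega> {0..<n}))"
    by (simp add: IT.distr_lim IT.CI_def up)
  also have "\<dots> = (\<integral>\<^sup>+\<omega>. ?F \<omega> \<partial>IT.C 0 n (\<lambda>_. undefined))"
    using less IT.sets_C[of "\<lambda>_. undefined" 0 n]
    by (subst nn_integral_distr)
       (simp_all add: meas_F space_PiM measurable_restrict_subset cong: measurable_cong_sets)
  also have "\<dots> = (\<integral>\<^sup>+z. indicator A z \<partial>pair_law p \<pi> \<sigma> s t)"
    unfolding n_def by (rule nn_integral_C_pair[OF nn_integral_C_single])
  also have "\<dots> = emeasure (pair_law p \<pi> \<sigma> s t) A"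
    by simp
  finally show "emeasure (distr (path_measure p \<pi> \<sigma> s) (count_space UNIV) (\<lambda>\<omega>. (\<omega> t, \<omega> (Suc t)))) A =
    emeasure (pair_law p \<pi> \<sigma> s t) A"
    by (simp add: path_measure_eq)
qed simp

end

lemma path_measurable_pair:
  "(\<lambda>\<omega>. (\<omega> t, \<omega> (Suc t))) \<in> path_measure p \<pi> \<sigma> s \<rightarrow>\<^sub>M count_space UNIV"
  using measurable_coordinate_pair[of t UNIV "Suc t"]
  by (simp add: measurable_cong_sets[OF sets_path_measure refl])

lemma prob_path_measure:
  "\<P>(\<omega> in path_measure p \<pi> \<sigma> s. Q (\<omega> t)) = measure_pmf.prob (state_law p \<pi> \<sigma> s t) {x. Q x}"
proof -
  have fst: "map_pmf fst (pair_law p \<pi> \<sigma> s t) = state_law p \<pi> \<sigma> s t"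
    by (simp add: pair_law_def map_bind_pmf map_pmf_comp bind_return_pmf')
  have "\<P>(\<omega> in path_measure p \<pi> \<sigma> s. Q (\<omega> t)) =
      measure (distr (path_measure p \<pi> \<sigma> s) (count_space UNIV) (\<lambda>\<omega>. (\<omega> t, \<omega> (Suc t)))) {z. Q (fst z)}"
    using path_measurable_pair by (subst measure_distr) (auto intro!: arg_cong2[where f = measure])
  also have "\<dots> = measure_pmf.prob (map_pmf fst (pair_law p \<pi> \<sigma> s t)) {x. Q x}"
    by (simp add: distr_path_pair vimage_def)
  finally show ?thesis
    by (simp add: fst)
qed

lemma
  fixes F :: "state \<times> state \<Rightarrow> real"
  shows integrable_path_pair:
    "integrable (path_measure p \<pi> \<sigma> s) (\<lambda>\<omega>. F (\<omega> t, \<omega> (Suc t))) \<longleftrightarrow>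
       integrable (pair_law p \<pi> \<sigma> s t) F"
  and integral_path_pair:
    "(\<integral>\<omega>. F (\<omega> t, \<omega> (Suc t)) \<partial>path_measure p \<pi> \<sigma> s) = (\<integral>z. F z \<partial>pair_law p \<pi> \<sigma> s t)"
  unfolding distr_path_pair[symmetric]
  using path_measurable_pair by (simp_all add: integrable_distr_eq integral_distr)

section \<open>Expectations\<close>

text \<open>By Tonelli the expected sum of the norms is the finite sum of their expectations, so the
  sum of the norms is finite almost everywhere. This is what exchanging series and integral
  requires.\<close>

lemma AE_summable_norm:
  fixes f :: "nat \<Rightarrow> 'a \<Rightarrow> 'b::{banach, second_countable_topology}"
  assumes int: "\<And>i. integrable M (f i)" and sums: "summable (\<lambda>i. \<integral>x. norm (f i x) \<partial>M)"
  shows "AE x in M. summable (\<lambda>i. norm (f i x))"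
proof -
  note [measurable] = borel_measurable_integrable[OF int]
  have "(\<integral>\<^sup>+x. (\<Sum>i. ennreal (norm (f i x))) \<partial>M) = (\<Sum>i. \<integral>\<^sup>+x. norm (f i x) \<partial>M)"
    by (rule nn_integral_suminf) simp
  also have "\<dots> = (\<Sum>i. ennreal (\<integral>x. norm (f i x) \<partial>M))"
    by (intro arg_cong[where f = suminf] ext nn_integral_eq_integral integrable_norm int) simp
  also have "\<dots> \<noteq> \<infinity>"
    using sums by (simp add: ennreal_suminf_neq_top)
  finally have "AE x in M. (\<Sum>i. ennreal (norm (f i x))) \<noteq> \<infinity>"
    by (intro nn_integral_PInf_AE) simp_all
  then show ?thesis
    by eventually_elim (rule summable_suminf_not_top, simp_all)
qed

lemma expectation_bind_finite:
  fixes g :: "'b \<Rightarrow> real"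
  assumes "finite A" "finite B" "set_pmf M \<subseteq> A" "\<And>x. x \<in> A \<Longrightarrow> set_pmf (N x) \<subseteq> B"
  shows "measure_pmf.expectation (M \<bind> N) g =
    measure_pmf.expectation M (\<lambda>x. measure_pmf.expectation (N x) g)"
proof -
  have "measure_pmf.expectation (M \<bind> N) g = (\<Sum>a\<in>A. pmf M a *\<^sub>R measure_pmf.expectation (N a) g)"
    using assms by (intro pmf_expectation_bind) (auto intro: finite_subset)
  also have "\<dots> = measure_pmf.expectation M (\<lambda>x. measure_pmf.expectation (N x) g)"
    using assms by (subst integral_measure_pmf[of A]) auto
  finally show ?thesis .
qed

lemma expectation_mono_finite:
  fixes f g :: "'a \<Rightarrow> real"
  assumes "finite A" "set_pmf M \<subseteq> A" "\<And>x. x \<in> A \<Longrightarrow> f x \<le> g x"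
  shows "measure_pmf.expectation M f \<le> measure_pmf.expectation M g"
  using assms
  by (intro integral_mono_AE integrable_measure_pmf_finite)
     (auto simp: AE_measure_pmf_iff intro: finite_subset)

lemma pmf_eq_1_imp_return:
  assumes "pmf M x = 1"
  shows "M = return_pmf x"
proof -
  have "AE y in M. y \<in> {x}"
    using assms by (subst measure_pmf.prob_eq_1[symmetric]) (simp_all add: measure_pmf_single)
  then have "set_pmf M \<subseteq> {x}"
    by (auto simp: AE_measure_pmf_iff)
  then show ?thesis
    by (simp add: set_pmf_subset_singleton)
qed

section \<open>Rules, actions and rewards\<close>

lemma Terminal_in_state_space [simp]: "Terminal \<in> state_space"
  by (simp add: state_space_def)

lemma Terminal_not_active [simp]: "Terminal \<notin> active_states"
  by (auto simp: active_states_def)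

lemma reward_Terminal [simp]: "reward Terminal y = 0"
  by (cases y) simp_all

lemma runner_rules_action: "f \<in> runner_rules \<Longrightarrow> x \<in> state_space \<Longrightarrow> f x \<in> runner_actions x"
  by (auto simp: runner_rules_def)

lemma pitcher_rules_action:
  "h \<in> pitcher_rules \<Longrightarrow> x \<in> state_space \<Longrightarrow> a \<in> runner_actions x \<Longrightarrow> h (x, a) \<in> pitcher_actions x a"
  by (force simp: pitcher_rules_def PiE_iff)

lemma runner_actions_nonempty: "runner_actions x \<noteq> {}"
  by (simp add: runner_actions_def)

lemma pitcher_actions_nonempty: "pitcher_actions x a \<noteq> {}"
  by (simp add: pitcher_actions_def)

lemma finite_pitcher_actions: "finite (pitcher_actions x a)"
  by (simp add: pitcher_actions_def)

lemma runner_rules_nonempty: "runner_rules \<noteq> {}"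
  by (simp add: runner_rules_def PiE_eq_empty_iff runner_actions_nonempty)

lemma pitcher_rules_nonempty: "pitcher_rules \<noteq> {}"
  by (auto simp add: pitcher_rules_def PiE_eq_empty_iff pitcher_actions_nonempty)

lemma stationary_runner: "f \<in> runner_rules \<Longrightarrow> stationary f \<in> runner_policies"
  by (simp add: stationary_def runner_policies_def)

lemma stationary_pitcher: "h \<in> pitcher_rules \<Longrightarrow> stationary h \<in> pitcher_policies"
  by (simp add: stationary_def pitcher_policies_def)

definition reward_bound :: real where
  "reward_bound = (\<Sum>(x, y)\<in>state_space \<times> state_space. \<bar>reward x y\<bar>)"

lemma reward_bound_nonneg: "0 \<le> reward_bound"
  unfolding reward_bound_def by (intro sum_nonneg) auto

text \<open>Nothing is earned from \<open>Terminal\<close>, hence the indicator: its expectation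
  turns reward bounds into multiples of the survival probability.\<close>

lemma abs_reward_le:
  assumes "x \<in> state_space" "y \<in> state_space"
  shows "\<bar>reward x y\<bar> \<le> reward_bound * indicator (- {Terminal}) x"
proof (cases "x = Terminal")
  case False
  have "\<bar>reward x y\<bar> \<le> reward_bound"
    unfolding reward_bound_def using assms finite_state_space
    by (intro member_le_sum[of "(x, y)" _ "\<lambda>(x, y). \<bar>reward x y\<bar>", simplified]) auto
  with False show ?thesis by simp
qed simp

section \<open>Geometric decay of the survival probability\<close>

locale game =
  fixes p :: transition
  assumes law: "transition_law p"
begin

lemma next_law_closed:
  assumes "f \<in> runner_rules" "h \<in> pitcher_rules" "x \<in> state_space"
  shows "set_pmf (next_law p f h x) \<subseteq> state_space"
  using law assms runner_rules_action[of f x] pitcher_rules_action[of h x "f x"]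
  unfolding transition_law_def next_law_def by blast

text \<open>Admissible rules can only play \<open>Dummy\<close> at \<open>Terminal\<close>, and for
  these actions the law is prescribed.\<close>

lemma next_law_Terminal:
  assumes "f \<in> runner_rules" "h \<in> pitcher_rules"
  shows "next_law p f h Terminal = return_pmf Terminal"
proof -
  have "f Terminal = Dummy"
    using runner_rules_action[of f Terminal] assms by (simp add: runner_actions_def)
  moreover have "h (Terminal, Dummy) = Dummy"
    using pitcher_rules_action[of h Terminal Dummy] assms
    by (simp add: pitcher_actions_def runner_actions_def)
  ultimately show ?thesis
    using law by (intro pmf_eq_1_imp_return) (simp add: transition_law_def next_law_def)
qed

lemma backup_eq_expectation:
  assumes "f \<in> runner_rules" "h \<in> pitcher_rules" "x \<in> state_space"
  shows "backup p u x (f x) (h (x, f x)) =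
    measure_pmf.expectation (next_law p f h x) (\<lambda>y. reward x y + u y)"
  unfolding backup_def
  using next_law_closed[OF assms] finite_state_space
  by (subst integral_measure_pmf_real[of state_space]) (auto simp: next_law_def)

lemma state_law_closed:
  assumes "\<pi> \<in> runner_policies" "\<sigma> \<in> pitcher_policies" "s \<in> state_space"
  shows "set_pmf (state_law p \<pi> \<sigma> s t) \<subseteq> state_space"
proof (induction t)
  case (Suc t)
  then show ?case
    using assms next_law_closed by (fastforce simp: runner_policies_def pitcher_policies_def)
qed (simp add: assms)

lemma state_law_Terminal:
  assumes "\<pi> \<in> runner_policies" "\<sigma> \<in> pitcher_policies"
  shows "state_law p \<pi> \<sigma> Terminal t = return_pmf Terminal"
  using assms
  by (induction t)
     (simp_all add: bind_return_pmf next_law_Terminal runner_policies_def pitcher_policies_def)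

definition survival :: "(nat \<Rightarrow> runner_rule) \<Rightarrow> (nat \<Rightarrow> pitcher_rule) \<Rightarrow> state \<Rightarrow> nat \<Rightarrow> real" where
  "survival \<pi> \<sigma> s t = measure_pmf.prob (state_law p \<pi> \<sigma> s t) (- {Terminal})"

lemma survival_nonneg: "0 \<le> survival \<pi> \<sigma> s t"
  by (simp add: survival_def)

lemma survival_le_1: "survival \<pi> \<sigma> s t \<le> 1"
  by (simp add: survival_def)

lemma survival_le_max:
  assumes "\<pi> \<in> runner_policies" "\<sigma> \<in> pitcher_policies" "s \<in> state_space"
  shows "survival \<pi> \<sigma> s m \<le> max_survival_prob p m"
proof -
  have "survival \<pi> \<sigma> s m = \<P>(\<omega> in path_measure p \<pi> \<sigma> s. \<omega> m \<noteq> Terminal)" for \<pi> \<sigma> s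
    by (simp add: survival_def prob_path_measure[where Q = "\<lambda>x. x \<noteq> Terminal"] Compl_eq)
  then have "max_survival_prob p m =
      (SUP (\<pi>, \<sigma>, s) \<in> runner_policies \<times> pitcher_policies \<times> state_space. survival \<pi> \<sigma> s m)"
    by (simp add: max_survival_prob_def)
  also have "\<dots> \<ge> survival \<pi> \<sigma> s m"
    using assms survival_le_1
    by (intro cSUP_upper2[where x = "(\<pi>, \<sigma>, s)"]) (auto intro!: bdd_aboveI[of _ 1])
  finally show ?thesis .
qed

text \<open>Condition on \<open>S_t\<close>: from \<open>Terminal\<close> survival is impossible,
  and from any other state the shifted policies obey the bound \<open>q\<close>. Both a block factor
  below 1 and the trivial \<open>q = 1\<close> are used later.\<close>

lemma survival_add_le:
  assumes pol: "\<pi> \<in> runner_policies" "\<sigma> \<in> pitcher_policies" "s \<in> state_space"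
    and le: "\<And>\<pi> \<sigma> x. \<pi> \<in> runner_policies \<Longrightarrow> \<sigma> \<in> pitcher_policies \<Longrightarrow> x \<in> state_space \<Longrightarrow>
      survival \<pi> \<sigma> x m \<le> q"
  shows "survival \<pi> \<sigma> s (t + m) \<le> q * survival \<pi> \<sigma> s t"
proof -
  let ?\<pi> = "\<lambda>i. \<pi> (t + i)" and ?\<sigma> = "\<lambda>i. \<sigma> (t + i)" and ?I = "indicator (- {Terminal}) :: state \<Rightarrow> real"
  have pol': "?\<pi> \<in> runner_policies" "?\<sigma> \<in> pitcher_policies"
    using pol by (simp_all add: runner_policies_def pitcher_policies_def)
  have "survival \<pi> \<sigma> s (t + m) = measure_pmf.expectation (state_law p \<pi> \<sigma> s (t + m)) ?I"
    by (simp add: survival_def)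
  also have "\<dots> = measure_pmf.expectation (state_law p \<pi> \<sigma> s t)
      (\<lambda>x. measure_pmf.expectation (state_law p ?\<pi> ?\<sigma> x m) ?I)"
    unfolding state_law_add
    by (intro expectation_bind_finite[of state_space state_space] finite_state_space
        state_law_closed pol pol')
  also have "\<dots> \<le> measure_pmf.expectation (state_law p \<pi> \<sigma> s t) (\<lambda>x. q * ?I x)"
  proof (rule expectation_mono_finite[OF finite_state_space state_law_closed[OF pol]])
    fix x assume "x \<in> state_space"
    then show "measure_pmf.expectation (state_law p ?\<pi> ?\<sigma> x m) ?I \<le> q * ?I x"
      using le[OF pol'] state_law_Terminal[OF pol'] by (cases "x = Terminal") (simp_all add: survival_def)
  qed
  also have "\<dots> = q * survival \<pi> \<sigma> s t"
    by (simp add: survival_def)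
  finally show ?thesis .
qed

lemma survival_geometric:
  assumes "m \<ge> 1" "max_survival_prob p m < 1"
  obtains C r where "0 \<le> C" "0 < r" "r < 1"
    "\<And>\<pi> \<sigma> s t. \<pi> \<in> runner_policies \<Longrightarrow> \<sigma> \<in> pitcher_policies \<Longrightarrow> s \<in> state_space \<Longrightarrow>
      survival \<pi> \<sigma> s t \<le> C * r ^ t"
proof -
  \<comment> \<open>The floor 1/2 keeps \<open>q\<close> positive, as the division by
    \<open>q\<close> below and the positivity of its root demand.\<close>
  define q where "q = max (max_survival_prob p m) (1 / 2)"
  have q: "0 < q" "q < 1" "max_survival_prob p m \<le> q"
    using assms by (simp_all add: q_def)
  define r where "r = root m q"
  have r: "0 < r" "r < 1" "r ^ m = q"
    using assms q by (simp_all add: r_def)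
  have "survival \<pi> \<sigma> s t \<le> 1 / q * r ^ t"
    if pol: "\<pi> \<in> runner_policies" "\<sigma> \<in> pitcher_policies" "s \<in> state_space" for \<pi> \<sigma> s t
  proof -
    have block: "survival \<pi> \<sigma> s (k * m) \<le> q ^ k" for k
    proof (induction k)
      case (Suc k)
      have "survival \<pi> \<sigma> s (k * m + m) \<le> q * survival \<pi> \<sigma> s (k * m)"
        by (rule survival_add_le[OF pol order_trans[OF survival_le_max q(3)]])
      also have "\<dots> \<le> q * q ^ k"
        using Suc q by simp
      finally show ?case by (simp add: add.commute)
    qed (simp add: survival_le_1)
    \<comment> \<open>Bound 1 for the incomplete block: survival does not increase over the
      remaining \<open>t mod m\<close> stages. The constant \<open>1 / q\<close> makes up for the
      missing powers of \<open>r\<close>, since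
      \<open>q = r ^ m \<le> r ^ (t mod m)\<close>.\<close>
    have "survival \<pi> \<sigma> s (t div m * m + t mod m) \<le> 1 * survival \<pi> \<sigma> s (t div m * m)"
      by (rule survival_add_le[OF pol survival_le_1])
    also have "\<dots> \<le> (r ^ m) ^ (t div m)"
      using block r by simp
    also have "\<dots> = r ^ (t div m * m)"
      by (simp add: power_mult mult.commute)
    also have "\<dots> \<le> r ^ (t div m * m) * (r ^ (t mod m) / q)"
    proof -
      have "q \<le> r ^ (t mod m)"
        unfolding r(3)[symmetric] using r assms
        by (intro power_decreasing) (auto intro: less_imp_le)
      then show ?thesis
        using r q by (simp add: field_simps)
    qed
    also have "\<dots> = 1 / q * r ^ (t div m * m + t mod m)"
      by (simp flip: power_add)
    finally show ?thesis by simp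
  qed
  with q r that[of "1 / q" r] show ?thesis by simp
qed

section \<open>Policy values as series of mean rewards\<close>

definition mean_reward :: "(nat \<Rightarrow> runner_rule) \<Rightarrow> (nat \<Rightarrow> pitcher_rule) \<Rightarrow> state \<Rightarrow> nat \<Rightarrow> real" where
  "mean_reward \<pi> \<sigma> s t = measure_pmf.expectation (pair_law p \<pi> \<sigma> s t) (\<lambda>(x, y). reward x y)"

context
  fixes \<pi> \<sigma> s
  assumes pol: "\<pi> \<in> runner_policies" "\<sigma> \<in> pitcher_policies" "s \<in> state_space"
begin

lemma policy_rules: "\<pi> t \<in> runner_rules" "\<sigma> t \<in> pitcher_rules"
  using pol by (simp_all add: runner_policies_def pitcher_policies_def)

lemma pair_law_closed: "set_pmf (pair_law p \<pi> \<sigma> s t) \<subseteq> state_space \<times> state_space"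
  using state_law_closed[OF pol, of t] next_law_closed[OF policy_rules[of t]]
  by (auto simp: pair_law_def)

lemma expectation_pair_law:
  fixes F :: "state \<times> state \<Rightarrow> real"
  shows "measure_pmf.expectation (pair_law p \<pi> \<sigma> s t) F =
    measure_pmf.expectation (state_law p \<pi> \<sigma> s t)
      (\<lambda>x. measure_pmf.expectation (next_law p (\<pi> t) (\<sigma> t) x) (\<lambda>y. F (x, y)))"
  unfolding pair_law_def
  by (subst expectation_bind_finite[of state_space "state_space \<times> state_space"])
     (use finite_state_space state_law_closed[OF pol] next_law_closed[OF policy_rules] in
       \<open>force simp: integral_map_pmf\<close>)+

lemma expectation_reward_abs_le:
  "measure_pmf.expectation (pair_law p \<pi> \<sigma> s t) (\<lambda>(x, y). \<bar>reward x y\<bar>)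
    \<le> reward_bound * survival \<pi> \<sigma> s t"
proof -
  have "measure_pmf.expectation (pair_law p \<pi> \<sigma> s t) (\<lambda>(x, y). \<bar>reward x y\<bar>)
    \<le> measure_pmf.expectation (pair_law p \<pi> \<sigma> s t)
        (\<lambda>z. reward_bound * indicator (- {Terminal}) (fst z))"
    by (rule expectation_mono_finite[OF _ pair_law_closed])
       (auto simp: finite_state_space abs_reward_le)
  also have "\<dots> = reward_bound * survival \<pi> \<sigma> s t"
    by (simp add: expectation_pair_law survival_def)
  finally show ?thesis .
qed

lemma abs_mean_reward_le: "\<bar>mean_reward \<pi> \<sigma> s t\<bar> \<le> reward_bound * survival \<pi> \<sigma> s t"
  unfolding mean_reward_def
  by (rule order_trans[OF integral_abs_bound]) (use expectation_reward_abs_le in \<open>simp add: case_prod_unfold\<close>)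

text \<open>Expected absolute rewards are dominated by multiples of the survival probabilities, so
  their sum converges and expectation and series may be exchanged.\<close>

lemma policy_value_sums:
  assumes "summable (survival \<pi> \<sigma> s)"
  shows "mean_reward \<pi> \<sigma> s sums policy_value p \<pi> \<sigma> s"
proof -
  let ?M = "path_measure p \<pi> \<sigma> s"
  have int: "integrable ?M (\<lambda>\<omega>. reward (\<omega> t) (\<omega> (Suc t)))" for t
    using integrable_path_pair[where F = "\<lambda>(x, y). reward x y"]
      integrable_measure_pmf_finite[OF finite_subset[OF pair_law_closed]] finite_state_space
    by simp
  have "summable (\<lambda>t. reward_bound * survival \<pi> \<sigma> s t)"
    using assms by (rule summable_mult)
  then have sums: "summable (\<lambda>t. \<integral>\<omega>. norm (reward (\<omega> t) (\<omega> (Suc t))) \<partial>?M)"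
    using expectation_reward_abs_le integral_path_pair[where F = "\<lambda>(x, y). \<bar>reward x y\<bar>"]
    by (elim summable_comparison_test'[where N = 0]) (simp add: case_prod_unfold integral_nonneg)
  have mean: "(\<integral>\<omega>. reward (\<omega> t) (\<omega> (Suc t)) \<partial>?M) = mean_reward \<pi> \<sigma> s t" for t
    using integral_path_pair[where F = "\<lambda>(x, y). reward x y"] by (simp add: mean_reward_def)
  note ae = AE_summable_norm[OF int sums]
  show ?thesis
    using integral_suminf[OF int ae sums] summable_integral[OF int ae sums]
    by (simp add: policy_value_def mean summable_sums)
qed

text \<open>A telescoping sum for an arbitrary sequence \<open>v\<close>: the last sum collects the
  expected one-step defects of \<open>v\<close> against the policy operators. Upper, lower or zero
  bounds on the defects then compare \<open>v 0 s\<close> with the \<open>n\<close>-stage value with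
  final payoff \<open>v n\<close>.\<close>

lemma value_iterates_identity:
  "v 0 s = (\<Sum>t<n. mean_reward \<pi> \<sigma> s t) + measure_pmf.expectation (state_law p \<pi> \<sigma> s n) (v n) +
     (\<Sum>t<n. measure_pmf.expectation (state_law p \<pi> \<sigma> s t)
        (\<lambda>x. v t x - policy_operator p (\<pi> t) (\<sigma> t) (v (Suc t)) x))"
proof (induction n)
  case (Suc n)
  let ?D = "state_law p \<pi> \<sigma> s"
  have int: "integrable (?D t) g" for t and g :: "state \<Rightarrow> real"
    using finite_subset[OF state_law_closed[OF pol] finite_state_space]
    by (rule integrable_measure_pmf_finite)
  \<comment> \<open>The integrands agree only almost everywhere, because a backup is known to be an
    expectation only at points of \<open>state_space\<close>.\<close>
  have "measure_pmf.expectation (?D n) (policy_operator p (\<pi> n) (\<sigma> n) (v (Suc n))) =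
      measure_pmf.expectation (?D n)
        (\<lambda>x. measure_pmf.expectation (next_law p (\<pi> n) (\<sigma> n) x) (reward x) +
             measure_pmf.expectation (next_law p (\<pi> n) (\<sigma> n) x) (v (Suc n)))"
  proof (intro integral_cong_AE)
    show "AE x in ?D n. policy_operator p (\<pi> n) (\<sigma> n) (v (Suc n)) x =
        measure_pmf.expectation (next_law p (\<pi> n) (\<sigma> n) x) (reward x) +
        measure_pmf.expectation (next_law p (\<pi> n) (\<sigma> n) x) (v (Suc n))"
      using state_law_closed[OF pol, of n] finite_subset[OF next_law_closed[OF policy_rules] finite_state_space]
      by (auto simp: AE_measure_pmf_iff policy_operator_def backup_eq_expectation[OF policy_rules]
          intro!: Bochner_Integration.integral_add integrable_measure_pmf_finite
          dest!: subsetD)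
  qed simp_all
  also have "\<dots> = mean_reward \<pi> \<sigma> s n + measure_pmf.expectation (?D (Suc n)) (v (Suc n))"
    using state_law_closed[OF pol, of n] next_law_closed[OF policy_rules] finite_state_space
    by (simp add: Bochner_Integration.integral_add[OF int int] mean_reward_def expectation_pair_law
        expectation_bind_finite[of state_space state_space])
  finally show ?case
    using Suc by (simp add: Bochner_Integration.integral_diff[OF int int])
qed simp

end

end

text \<open>The error consists of the rewards after stage \<open>n\<close> and the final payoff.
  Both vanish once \<open>Terminal\<close> is reached, the latter by \<open>u Terminal = 0\<close>,
  so both inherit the uniform geometric decay of survival.\<close>

lemma (in game) truncation_error_bound:
  assumes m: "m \<ge> 1" "max_survival_prob p m < 1" and u: "u Terminal = 0"
  obtains \<tau> where "\<tau> \<longlonglongrightarrow> 0"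
    "\<And>\<pi> \<sigma> s n. \<pi> \<in> runner_policies \<Longrightarrow> \<sigma> \<in> pitcher_policies \<Longrightarrow> s \<in> state_space \<Longrightarrow>
      \<bar>policy_value p \<pi> \<sigma> s - ((\<Sum>t<n. mean_reward \<pi> \<sigma> s t) +
         measure_pmf.expectation (state_law p \<pi> \<sigma> s n) u)\<bar> \<le> \<tau> n"
proof -
  obtain C r where r: "0 \<le> C" "0 < r" "r < 1"
    and surv: "\<And>\<pi> \<sigma> s t. \<pi> \<in> runner_policies \<Longrightarrow> \<sigma> \<in> pitcher_policies \<Longrightarrow> s \<in> state_space \<Longrightarrow>
      survival \<pi> \<sigma> s t \<le> C * r ^ t"
    using survival_geometric[OF m] by metis
  define B where "B = (\<Sum>x\<in>state_space. \<bar>u x\<bar>)"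
  have B: "\<bar>u x\<bar> \<le> B * indicator (- {Terminal}) x" if "x \<in> state_space" for x
    using that u finite_state_space unfolding B_def
    by (cases "x = Terminal") (auto intro!: member_le_sum)
  have B_nonneg: "0 \<le> B"
    by (simp add: B_def sum_nonneg)
  let ?K = "reward_bound * C"
  \<comment> \<open>The first summand is the geometric tail of the rewards, the second bounds the
    final payoff.\<close>
  define \<tau> where "\<tau> n = (?K / (1 - r) + B * C) * r ^ n" for n
  show ?thesis
  proof
    show "\<tau> \<longlonglongrightarrow> 0"
      unfolding \<tau>_def using r by (intro tendsto_mult_right_zero LIMSEQ_power_zero) simp
  next
    fix \<pi> \<sigma> s n
    assume pol: "\<pi> \<in> runner_policies" "\<sigma> \<in> pitcher_policies" "s \<in> state_space"
    have geo: "summable (\<lambda>t. c * r ^ t)" for c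
      using r by (intro summable_mult summable_geometric) simp
    have "summable (survival \<pi> \<sigma> s)"
      using surv[OF pol] survival_nonneg by (intro summable_comparison_test'[OF geo[of C], of 0]) simp
    then have V: "mean_reward \<pi> \<sigma> s sums policy_value p \<pi> \<sigma> s"
      by (rule policy_value_sums[OF pol])
    have bound: "\<bar>mean_reward \<pi> \<sigma> s t\<bar> \<le> ?K * r ^ t" for t
      using abs_mean_reward_le[OF pol, of t] mult_left_mono[OF surv[OF pol, of t] reward_bound_nonneg]
      by (simp add: mult.assoc)
    have "\<bar>\<Sum>t. mean_reward \<pi> \<sigma> s (t + n)\<bar> \<le> (\<Sum>t. ?K * r ^ n * r ^ t)"
      using bound[of "_ + n"] geo[of "?K * r ^ n"]
      by (intro norm_suminf_le[where 'a = real, unfolded real_norm_def]) (simp_all add: power_add mult_ac)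
    also have "\<dots> = ?K * r ^ n * (1 / (1 - r))"
      using r by (subst suminf_mult) (simp_all add: suminf_geometric)
    finally have tail: "\<bar>policy_value p \<pi> \<sigma> s - (\<Sum>t<n. mean_reward \<pi> \<sigma> s t)\<bar> \<le> ?K / (1 - r) * r ^ n"
      using suminf_minus_initial_segment[OF sums_summable[OF V], of n] sums_unique[OF V] by simp
    have "\<bar>measure_pmf.expectation (state_law p \<pi> \<sigma> s n) u\<bar>
        \<le> measure_pmf.expectation (state_law p \<pi> \<sigma> s n) (\<lambda>x. \<bar>u x\<bar>)"
      by (rule integral_abs_bound)
    also have "\<dots> \<le> measure_pmf.expectation (state_law p \<pi> \<sigma> s n) (\<lambda>x. B * indicator (- {Terminal}) x)"
      by (intro expectation_mono_finite[OF finite_state_space state_law_closed[OF pol] B])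
    also have "\<dots> = B * survival \<pi> \<sigma> s n"
      by (simp add: survival_def)
    also have "\<dots> \<le> B * C * r ^ n"
      using mult_left_mono[OF surv[OF pol, of n] B_nonneg] by (simp add: mult.assoc)
    finally show "\<bar>policy_value p \<pi> \<sigma> s - ((\<Sum>t<n. mean_reward \<pi> \<sigma> s t) +
         measure_pmf.expectation (state_law p \<pi> \<sigma> s n) u)\<bar> \<le> \<tau> n"
      using tail by (simp add: \<tau>_def distrib_right)
  qed
qed

text \<open>Backward recursion for the value with \<open>n - t\<close> stages to go;
  \<open>t < n\<close> keeps the truncated subtraction exact.\<close>

lemma funpow_diff: "t < n \<Longrightarrow> (T ^^ (n - t)) u = T ((T ^^ (n - Suc t)) u)"
  by (simp flip: Suc_diff_Suc)

section \<open>Nearly optimal and optimal one-stage rules\<close>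

context game
begin

text \<open>The bound is independent of the actions, so the supremum over the runner's infinite
  action set is that of a bounded set.\<close>

lemma abs_backup_le: "\<bar>backup p u x a a'\<bar> \<le> (\<Sum>y\<in>state_space. \<bar>reward x y + u y\<bar>)"
proof -
  have "\<bar>backup p u x a a'\<bar> \<le> (\<Sum>y\<in>state_space. \<bar>(reward x y + u y) * pmf (p x a a') y\<bar>)"
    unfolding backup_def by (rule sum_abs)
  also have "\<dots> \<le> (\<Sum>y\<in>state_space. \<bar>reward x y + u y\<bar>)"
    by (intro sum_mono) (simp add: abs_mult mult_left_le pmf_le_1)
  finally show ?thesis .
qed

lemma bdd_above_INF_backup:
  "bdd_above ((\<lambda>a. INF a'\<in>pitcher_actions x a. backup p u x a a') ` A)"
proof (rule bdd_aboveI2)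
  fix a
  obtain a' where a': "a' \<in> pitcher_actions x a"
    using pitcher_actions_nonempty by blast
  then have "(INF a'\<in>pitcher_actions x a. backup p u x a a') \<le> backup p u x a a'"
    by (intro cINF_lower) (simp_all add: finite_pitcher_actions)
  also have "\<dots> \<le> (\<Sum>y\<in>state_space. \<bar>reward x y + u y\<bar>)"
    using abs_backup_le[of u x a a'] by simp
  finally show "(INF a'\<in>pitcher_actions x a. backup p u x a a') \<le> \<dots>" .
qed

text \<open>The supremum over the interval of actions need not be attained, so a slack
  \<open>e\<close> is conceded; one choice per state gives a rule good against every pitcher
  rule.\<close>

lemma nearly_optimal_runner_rule:
  assumes "0 < e"
  obtains f where "f \<in> runner_rules"
    "\<And>h x. h \<in> pitcher_rules \<Longrightarrow> x \<in> state_space \<Longrightarrow>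
      bellman_operator p u x - e \<le> policy_operator p f h u x"
proof -
  have "\<exists>a\<in>runner_actions x. \<forall>a'\<in>pitcher_actions x a. bellman_operator p u x - e \<le> backup p u x a a'" for x
  proof -
    have "bellman_operator p u x - e < bellman_operator p u x"
      using assms by simp
    then obtain a where a: "a \<in> runner_actions x"
      "bellman_operator p u x - e < (INF a'\<in>pitcher_actions x a. backup p u x a a')"
      unfolding bellman_operator_def
      by (subst (asm) less_cSUP_iff) (auto simp: runner_actions_nonempty bdd_above_INF_backup)
    have "bellman_operator p u x - e \<le> backup p u x a a'" if "a' \<in> pitcher_actions x a" for a'
      using a(2) cINF_lower[OF _ that, of "backup p u x a"] by (simp add: finite_pitcher_actions)
    with a(1) show ?thesis by blast
  qed
  then obtain F where F: "\<And>x. F x \<in> runner_actions x"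
    "\<And>x a'. a' \<in> pitcher_actions x (F x) \<Longrightarrow> bellman_operator p u x - e \<le> backup p u x (F x) a'"
    by metis
  show ?thesis
  proof
    show "restrict F state_space \<in> runner_rules"
      using F by (simp add: runner_rules_def)
    show "bellman_operator p u x - e \<le> policy_operator p (restrict F state_space) h u x"
      if "h \<in> pitcher_rules" "x \<in> state_space" for h x
      using F that by (simp add: policy_operator_def pitcher_rules_action)
  qed
qed

text \<open>The pitcher has finitely many actions, so the infimum is attained without slack. The
  minimizer depends on the pair \<open>(x, a)\<close> only, hence a single \<open>h\<close> serves
  against every \<open>f\<close>.\<close>

lemma optimal_pitcher_rule:
  obtains h where "h \<in> pitcher_rules"
    "\<And>f x. f \<in> runner_rules \<Longrightarrow> x \<in> state_space \<Longrightarrow> policy_operator p f h u x \<le> bellman_operator p u x"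
proof -
  have "\<exists>a'\<in>pitcher_actions x a. a \<in> runner_actions x \<longrightarrow> backup p u x a a' \<le> bellman_operator p u x" for x a
  proof -
    have "(INF a'\<in>pitcher_actions x a. backup p u x a a') \<in> backup p u x a ` pitcher_actions x a"
      by (intro closed_contains_Inf) (auto simp: finite_pitcher_actions pitcher_actions_nonempty finite_imp_closed)
    moreover have "(INF a'\<in>pitcher_actions x a. backup p u x a a') \<le> bellman_operator p u x"
      if "a \<in> runner_actions x"
      unfolding bellman_operator_def by (rule cSUP_upper[OF that bdd_above_INF_backup])
    ultimately show ?thesis by auto
  qed
  then obtain H where H: "\<And>x a. H x a \<in> pitcher_actions x a"
    "\<And>x a. a \<in> runner_actions x \<Longrightarrow> backup p u x a (H x a) \<le> bellman_operator p u x"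
    by metis
  let ?h = "restrict (\<lambda>(x, a). H x a) (SIGMA x:state_space. runner_actions x)"
  show ?thesis
  proof
    show "?h \<in> pitcher_rules"
      using H by (auto simp: pitcher_rules_def)
    show "policy_operator p f ?h u x \<le> bellman_operator p u x"
      if "f \<in> runner_rules" "x \<in> state_space" for f x
      using H that by (simp add: policy_operator_def runner_rules_action)
  qed
qed

end

section \<open>Convergence of value iteration and of policy evaluation\<close>

theorem theorem1:
  fixes p :: transition and u0 :: "state \<Rightarrow> real"
  assumes "transition_law p"
    and "\<exists>m\<ge>1. max_survival_prob p m < 1"
    and "u0 Terminal = 0"
  shows "(\<forall>s\<in>state_space.
            (\<lambda>k. (bellman_operator p ^^ k) u0 s) \<longlonglongrightarrow> game_value p s) \<and>
         (\<forall>f\<in>runner_rules. \<forall>h\<in>pitcher_rules. \<forall>s\<in>state_space.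
            (\<lambda>k. (policy_operator p f h ^^ k) u0 s)
              \<longlonglongrightarrow> policy_value p (stationary f) (stationary h) s)"
proof -
  interpret game p by standard (rule assms(1))
  let ?E = "\<lambda>\<pi> \<sigma> s t. measure_pmf.expectation (state_law p \<pi> \<sigma> s t) :: (state \<Rightarrow> real) \<Rightarrow> real"
  obtain m where m: "m \<ge> 1" "max_survival_prob p m < 1"
    using assms(2) by blast
  obtain \<tau> where \<tau>: "\<tau> \<longlonglongrightarrow> 0" and trunc:
    "\<And>\<pi> \<sigma> s n. \<pi> \<in> runner_policies \<Longrightarrow> \<sigma> \<in> pitcher_policies \<Longrightarrow> s \<in> state_space \<Longrightarrow>
      \<bar>policy_value p \<pi> \<sigma> s - ((\<Sum>t<n. mean_reward \<pi> \<sigma> s t) + ?E \<pi> \<sigma> s n u0)\<bar> \<le> \<tau> n"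
    using truncation_error_bound[where u = u0, OF m assms(3)] by blast
  have limI: "u \<longlonglongrightarrow> L" if "\<And>n. \<bar>u n - L\<bar> \<le> \<tau> n" for u :: "nat \<Rightarrow> real" and L
  proof (rule LIM_zero_cancel)
    show "(\<lambda>n. u n - L) \<longlonglongrightarrow> 0"
      using that by (intro Lim_null_comparison[OF _ \<tau>]) simp
  qed
  have E_mono: "?E \<pi> \<sigma> s t g \<le> ?E \<pi> \<sigma> s t g'"
    if "\<pi> \<in> runner_policies" "\<sigma> \<in> pitcher_policies" "s \<in> state_space" "\<And>x. x \<in> state_space \<Longrightarrow> g x \<le> g' x"
    for \<pi> \<sigma> s t g g'
    using that by (intro expectation_mono_finite[OF finite_state_space state_law_closed])
  \<comment> \<open>The case \<open>n = 0\<close> of \<open>trunc\<close>: the sum is empty and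
    \<open>S_0 = s\<close>. It makes the real suprema and infima below ranges over bounded
    sets.\<close>
  have value_bounded: "\<bar>policy_value p \<pi> \<sigma> s\<bar> \<le> \<tau> 0 + \<bar>u0 s\<bar>"
    if "\<pi> \<in> runner_policies" "\<sigma> \<in> pitcher_policies" "s \<in> state_space" for \<pi> \<sigma> s
    using trunc[OF that, of 0] by simp
  obtain f0 h0 where "f0 \<in> runner_rules" "h0 \<in> pitcher_rules"
    using runner_rules_nonempty pitcher_rules_nonempty by blast
  then have nonempty: "runner_policies \<noteq> {}" "pitcher_policies \<noteq> {}"
    using stationary_runner stationary_pitcher by blast+
  have game: "\<bar>(bellman_operator p ^^ n) u0 s - game_value p s\<bar> \<le> \<tau> n" if s: "s \<in> state_space" for s n
  proof -
    let ?INF = "\<lambda>\<pi>. INF \<sigma>\<in>pitcher_policies. policy_value p \<pi> \<sigma> s"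
    \<comment> \<open>The value with \<open>n - t\<close> stages to go: \<open>?v 0\<close> is the
      iterate in question and \<open>?v n\<close> is \<open>u0\<close>.\<close>
    let ?v = "\<lambda>t. (bellman_operator p ^^ (n - t)) u0"
    have bdd_below: "bdd_below ((\<lambda>\<sigma>. policy_value p \<pi> \<sigma> s) ` pitcher_policies)"
      if "\<pi> \<in> runner_policies" for \<pi>
    proof (rule bdd_belowI2)
      show "- (\<tau> 0 + \<bar>u0 s\<bar>) \<le> policy_value p \<pi> \<sigma> s" if "\<sigma> \<in> pitcher_policies" for \<sigma>
        using value_bounded[OF \<open>\<pi> \<in> runner_policies\<close> that s] by linarith
    qed
    have "(bellman_operator p ^^ n) u0 s \<le> game_value p s + \<tau> n + \<epsilon>" if "0 < \<epsilon>" for \<epsilon>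
    proof -
      \<comment> \<open>Each of \<open>n\<close> stages may lose \<open>e\<close>;
        \<open>Suc n\<close> avoids division by zero.\<close>
      define e where "e = \<epsilon> / Suc n"
      have "0 < e" "n * e \<le> \<epsilon>"
        using that by (simp_all add: e_def field_simps)
      have "\<exists>f\<in>runner_rules. \<forall>h\<in>pitcher_rules. \<forall>x\<in>state_space.
          bellman_operator p u x - e \<le> policy_operator p f h u x" for u
        by (rule nearly_optimal_runner_rule[OF \<open>0 < e\<close>]) blast
      then obtain F where F: "\<And>u. F u \<in> runner_rules" "\<And>u h x. h \<in> pitcher_rules \<Longrightarrow> x \<in> state_space \<Longrightarrow>
          bellman_operator p u x - e \<le> policy_operator p (F u) h u x"
        by metis
      \<comment> \<open>From stage \<open>n\<close> on the subtraction gives 0 and the rule is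
        \<open>F u0\<close>: some admissible continuation, whose effect \<open>\<tau> n\<close>
        absorbs.\<close>
      define \<pi> where "\<pi> t = F (?v (Suc t))" for t
      have \<pi>: "\<pi> \<in> runner_policies"
        by (simp add: runner_policies_def \<pi>_def F)
      have "?v 0 s - \<tau> n - \<epsilon> \<le> policy_value p \<pi> \<sigma> s" if \<sigma>: "\<sigma> \<in> pitcher_policies" for \<sigma>
      proof -
        have "(\<Sum>t<n. ?E \<pi> \<sigma> s t (\<lambda>x. ?v t x - policy_operator p (\<pi> t) (\<sigma> t) (?v (Suc t)) x))
            \<le> (\<Sum>t<n. ?E \<pi> \<sigma> s t (\<lambda>x. e))"
        proof (intro sum_mono E_mono[OF \<pi> \<sigma> s])
          fix t x assume "t \<in> {..<n}" "x \<in> state_space"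
          then show "?v t x - policy_operator p (\<pi> t) (\<sigma> t) (?v (Suc t)) x \<le> e"
            using F(2)[of "\<sigma> t" x "?v (Suc t)"] \<sigma> by (simp add: funpow_diff \<pi>_def pitcher_policies_def)
        qed
        with value_iterates_identity[OF \<pi> \<sigma> s, of ?v n] trunc[OF \<pi> \<sigma> s, of n] \<open>n * e \<le> \<epsilon>\<close>
        show ?thesis by (simp add: abs_le_iff)
      qed
      then have "?v 0 s - \<tau> n - \<epsilon> \<le> ?INF \<pi>"
        by (intro cINF_greatest nonempty)
      also have "\<dots> \<le> game_value p s"
        unfolding game_value_def
      \<comment> \<open>The supremum must range over a bounded set; each infimum lies below the
        value against any one pitcher policy.\<close>
      proof (intro cSUP_upper \<pi> bdd_aboveI2)
        fix \<pi>' assume \<pi>': "\<pi>' \<in> runner_policies"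
        obtain \<sigma> where \<sigma>: "\<sigma> \<in> pitcher_policies"
          using nonempty by blast
        show "?INF \<pi>' \<le> \<tau> 0 + \<bar>u0 s\<bar>"
          using cINF_lower[OF bdd_below[OF \<pi>'] \<sigma>] value_bounded[OF \<pi>' \<sigma> s] by simp
      qed
      finally show ?thesis by simp
    qed
    then have lower: "(bellman_operator p ^^ n) u0 s \<le> game_value p s + \<tau> n"
      by (rule field_le_epsilon)
    have "\<exists>h\<in>pitcher_rules. \<forall>f\<in>runner_rules. \<forall>x\<in>state_space.
        policy_operator p f h u x \<le> bellman_operator p u x" for u
      by (rule optimal_pitcher_rule) blast
    then obtain H where H: "\<And>u. H u \<in> pitcher_rules" "\<And>u f x. f \<in> runner_rules \<Longrightarrow> x \<in> state_space \<Longrightarrow>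
        policy_operator p f (H u) u x \<le> bellman_operator p u x"
      by metis
    \<comment> \<open>Chosen before any runner policy is fixed, so this one \<open>\<sigma>\<close>
      bounds the infimum for every \<open>\<pi>\<close>; its defects are nonnegative.\<close>
    define \<sigma> where "\<sigma> t = H (?v (Suc t))" for t
    have \<sigma>: "\<sigma> \<in> pitcher_policies"
      by (simp add: pitcher_policies_def \<sigma>_def H)
    have "?INF \<pi> \<le> ?v 0 s + \<tau> n" if \<pi>: "\<pi> \<in> runner_policies" for \<pi>
    proof -
      have "(\<Sum>t<n. ?E \<pi> \<sigma> s t (\<lambda>x. 0))
          \<le> (\<Sum>t<n. ?E \<pi> \<sigma> s t (\<lambda>x. ?v t x - policy_operator p (\<pi> t) (\<sigma> t) (?v (Suc t)) x))"
      proof (intro sum_mono E_mono[OF \<pi> \<sigma> s])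
        fix t x assume "t \<in> {..<n}" "x \<in> state_space"
        then show "0 \<le> ?v t x - policy_operator p (\<pi> t) (\<sigma> t) (?v (Suc t)) x"
          using H(2)[of "\<pi> t" x "?v (Suc t)"] \<pi> by (simp add: funpow_diff \<sigma>_def runner_policies_def)
      qed
      with value_iterates_identity[OF \<pi> \<sigma> s, of ?v n] trunc[OF \<pi> \<sigma> s, of n]
      have "policy_value p \<pi> \<sigma> s \<le> ?v 0 s + \<tau> n"
        by (simp add: abs_le_iff)
      with cINF_lower[OF bdd_below[OF \<pi>] \<sigma>] show ?thesis by simp
    qed
    then have "game_value p s \<le> ?v 0 s + \<tau> n"
      unfolding game_value_def by (intro cSUP_least nonempty)
    with lower show ?thesis by simp
  qed
  have policy: "\<bar>(policy_operator p f h ^^ n) u0 s - policy_value p (stationary f) (stationary h) s\<bar> \<le> \<tau> n"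
    if "f \<in> runner_rules" "h \<in> pitcher_rules" and s: "s \<in> state_space" for f h s n
  proof -
    note pol = stationary_runner[OF that(1)] stationary_pitcher[OF that(2)] s
    \<comment> \<open>For iterates of the fixed operator every defect is zero, so the
      \<open>n\<close>-th iterate is exactly the \<open>n\<close>-stage value.\<close>
    let ?v = "\<lambda>t. (policy_operator p f h ^^ (n - t)) u0"
    have "?v 0 s = (\<Sum>t<n. mean_reward (stationary f) (stationary h) s t) +
        ?E (stationary f) (stationary h) s n u0"
      using value_iterates_identity[OF pol, of ?v n] by (simp add: funpow_diff stationary_def)
    with trunc[OF pol, of n] show ?thesis by simp
  qed
  show ?thesis
    using limI[OF game] limI[OF policy] by blast
qed

end
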